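(* Suppose $n\ge 400$, and $\epsilon_{\max},\alpha\in(0,1)$ are constants satisfying $\overline{q}(\epsilon_{\max})\le 1$. For $\theta\in\mathbb{R}$ and $\epsilon\in[0,\epsilon_{\max}]$ set $r_\epsilon=\overline{r}(\epsilon)$, let $t_\epsilon$ be the largest element of $$\Big\{t:\ \overline{r}(\epsilon)\le t\le\overline{r}(\epsilon)+F^{-1}(1-\overline{q}(\epsilon)),\ 1-F(t-\overline{r}(\epsilon))-\tfrac{6}{1-\epsilon_{\max}}(1-F(t))\ge 0\Big\},$$ and define the testing functions $$\phi_{\theta,\theta-r_\epsilon,\epsilon}=\mathbf{1}\Big\{\tfrac1n\sum_{i=1}^n\mathbf{1}\{X_i-(\theta-r_\epsilon)\ge t_\epsilon\}\le\tfrac32\Big(1-F(t_\epsilon)+\tfrac{10\log(4/\alpha)}{9n}+\epsilon\Big)\Big\},$$ $$\phi_{\theta,\theta+r_\epsilon,\epsilon}=\mathbf{1}\Big\{\tfrac1n\sum_{i=1}^n\mathbf{1}\{X_i-(\theta+r_\epsilon)\le -t_\epsilon\}<\tfrac32\Big(1-F(t_\epsilon)+\tfrac{10\log(4/\alpha)}{9n}+\epsilon\Big)\Big\}.$$ Then, for each choice of sign $\pm$ separately, $$\text{(simultaneous Type-1 error)}\quad\sup_Q P_{\epsilon_{\max},\theta,Q}\Big(\sup_{\epsilon\in[0,\epsilon_{\max}]}\phi_{\theta,\theta\pm\overline{r}(\epsilon),\epsilon}=1\Big)\le\frac{\alpha}{4},$$ $$\text{(Type-2 error)}\quad\sup_Q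 P_{\epsilon,\theta\pm\overline{r}(\epsilon),Q}\big(\phi_{\theta,\theta\pm\overline{r}(\epsilon),\epsilon}=0\big)\le\frac{\alpha}{4},$$ for all $\theta\in\mathbb{R}$ and $\epsilon\in[0,\epsilon_{\max}]$.
   Context: Location model: $X\sim P_\theta$ iff $X-\theta\sim P_0$, where $P_0$ is a distribution on $\mathbb{R}$ with a density $f$ that is continuous on its support and symmetric around $0$; $F$ is the CDF of $P_0$ and $F^{-1}(q)=\inf\{t\in\mathbb{R}:F(t)\ge q\}$. For $\epsilon\in[0,1]$, $\theta\in\mathbb{R}$ and an arbitrary distribution $Q$ on $\mathbb{R}$, $P_{\epsilon,\theta,Q}=(1-\epsilon)P_\theta+\epsilon Q$; the data are $X_1,\ldots,X_n\overset{iid}{\sim}P_{\epsilon,\theta,Q}$ and $P_{\epsilon,\theta,Q}(\cdot)$ of an event about the data is its probability under this sampling. Suprema over $Q$ are over all probability distributions on $\mathbb{R}$. For $\epsilon\in[0,\epsilon_{\max}]$ define $$\overline{q}(\epsilon)=\frac{6}{1-\epsilon_{\max}}\left(\epsilon+\frac{100\log(32/\alpha)}{3(1-\epsilon_{\max})n}\right),$$ $$\overline{r}(\epsilon)=\inf\left\{r\ge 0:\ \sup_{r\le t\le r+F^{-1}(1-\overline{q}(\epsilon))}\Big(1-F(t-r)-\frac{6}{1-\epsilon_{\max}}(1-F(t))\Big)\ge 0\right\}.$$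
   Formalization: If q̄(ε) > 1/2 (allowed by q̄(ε_max) ≤ 1), the t-interval is empty, r̄(ε) = ∞ and t_ε does not exist; for such ε the tests are set to 0 and the Type-2 bound is claimed only when r̄(ε) < ∞. *)

theory Defs
  imports "HOL-Probability.Probability"
begin

definition base_law :: "(real \<Rightarrow> real) \<Rightarrow> real measure" where
  "base_law f = density lborel (\<lambda>x. ennreal (f x))"

abbreviation base_cdf :: "(real \<Rightarrow> real) \<Rightarrow> real \<Rightarrow> real" where
  "base_cdf f \<equiv> cdf (base_law f)"

text \<open>Extended-real valued, so that the quantile at level 0 is minus infinity.\<close>

definition base_quantile :: "(real \<Rightarrow> real) \<Rightarrow> real \<Rightarrow> ereal" where
  "base_quantile f q = (INF t\<in>{t. base_cdf f t \<ge> q}. ereal t)"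

definition location_law :: "(real \<Rightarrow> real) \<Rightarrow> real \<Rightarrow> real measure" where
  "location_law f \<theta> = distr (base_law f) borel (\<lambda>x. x + \<theta>)"

definition prob_laws :: "real measure set" where
  "prob_laws = {Q. prob_space Q \<and> sets Q = sets borel}"

definition contaminated :: "(real \<Rightarrow> real) \<Rightarrow> real \<Rightarrow> real \<Rightarrow> real measure \<Rightarrow> real measure" where
  "contaminated f \<epsilon> \<theta> Q = measure_of UNIV (sets borel)
     (\<lambda>A. ennreal (1 - \<epsilon>) * emeasure (location_law f \<theta>) A + ennreal \<epsilon> * emeasure Q A)"

definition sample_law ::
  "(real \<Rightarrow> real) \<Rightarrow> nat \<Rightarrow> real \<Rightarrow> real \<Rightarrow> real measure \<Rightarrow> (nat \<Rightarrow> real) measure" where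
  "sample_law f n \<epsilon> \<theta> Q = (\<Pi>\<^sub>M i\<in>{1..n}. contaminated f \<epsilon> \<theta> Q)"

definition qbar :: "nat \<Rightarrow> real \<Rightarrow> real \<Rightarrow> real \<Rightarrow> real" where
  "qbar n \<epsilon>max \<alpha> \<epsilon> =
     6 / (1 - \<epsilon>max) * (\<epsilon> + 100 * ln (32 / \<alpha>) / (3 * (1 - \<epsilon>max) * real n))"

definition gap :: "(real \<Rightarrow> real) \<Rightarrow> real \<Rightarrow> real \<Rightarrow> real \<Rightarrow> real" where
  "gap f \<epsilon>max r t = 1 - base_cdf f (t - r) - 6 / (1 - \<epsilon>max) * (1 - base_cdf f t)"

text \<open>Infimum and supremum are taken in the extended reals, with the usual values for the empty
  set. If the level \<open>qbar\<close> exceeds 1/2, the quantile is negative, every supremum below is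
  over the empty set, and \<open>rbar\<close> is infinite.\<close>

definition rbar :: "(real \<Rightarrow> real) \<Rightarrow> nat \<Rightarrow> real \<Rightarrow> real \<Rightarrow> real \<Rightarrow> ereal" where
  "rbar f n \<epsilon>max \<alpha> \<epsilon> =
     (INF r\<in>{r. 0 \<le> r \<and>
        (SUP t\<in>{t. r \<le> t \<and> ereal t \<le> ereal r + base_quantile f (1 - qbar n \<epsilon>max \<alpha> \<epsilon>)}.
           ereal (gap f \<epsilon>max r t)) \<ge> 0}. ereal r)"

definition reps :: "(real \<Rightarrow> real) \<Rightarrow> nat \<Rightarrow> real \<Rightarrow> real \<Rightarrow> real \<Rightarrow> real" where
  "reps f n \<epsilon>max \<alpha> \<epsilon> = real_of_ereal (rbar f n \<epsilon>max \<alpha> \<epsilon>)"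

definition teps :: "(real \<Rightarrow> real) \<Rightarrow> nat \<Rightarrow> real \<Rightarrow> real \<Rightarrow> real \<Rightarrow> real" where
  "teps f n \<epsilon>max \<alpha> \<epsilon> =
     (GREATEST t. rbar f n \<epsilon>max \<alpha> \<epsilon> \<le> ereal t \<and>
        ereal t \<le> rbar f n \<epsilon>max \<alpha> \<epsilon> + base_quantile f (1 - qbar n \<epsilon>max \<alpha> \<epsilon>) \<and>
        gap f \<epsilon>max (reps f n \<epsilon>max \<alpha> \<epsilon>) t \<ge> 0)"

definition threshold :: "(real \<Rightarrow> real) \<Rightarrow> nat \<Rightarrow> real \<Rightarrow> real \<Rightarrow> real \<Rightarrow> real" where
  "threshold f n \<epsilon>max \<alpha> \<epsilon> =
     3 / 2 * (1 - base_cdf f (teps f n \<epsilon>max \<alpha> \<epsilon>) + 10 * ln (4 / \<alpha>) / (9 * real n) + \<epsilon>)"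

text \<open>Tests of \<open>\<theta>\<close> against \<open>\<theta> - rbar\<close> and \<open>\<theta> + rbar\<close>. If \<open>rbar\<close> is infinite there is no
  alternative to test against and no critical point \<open>teps\<close>; the test then never rejects.\<close>

definition phi_minus ::
  "(real \<Rightarrow> real) \<Rightarrow> nat \<Rightarrow> real \<Rightarrow> real \<Rightarrow> real \<Rightarrow> real \<Rightarrow> (nat \<Rightarrow> real) \<Rightarrow> real" where
  "phi_minus f n \<epsilon>max \<alpha> \<theta> \<epsilon> X = of_bool (rbar f n \<epsilon>max \<alpha> \<epsilon> < \<infinity> \<and>
     1 / real n * (\<Sum>i=1..n. of_bool (X i - (\<theta> - reps f n \<epsilon>max \<alpha> \<epsilon>) \<ge> teps f n \<epsilon>max \<alpha> \<epsilon>))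
       \<le> threshold f n \<epsilon>max \<alpha> \<epsilon>)"

definition phi_plus ::
  "(real \<Rightarrow> real) \<Rightarrow> nat \<Rightarrow> real \<Rightarrow> real \<Rightarrow> real \<Rightarrow> real \<Rightarrow> (nat \<Rightarrow> real) \<Rightarrow> real" where
  "phi_plus f n \<epsilon>max \<alpha> \<theta> \<epsilon> X = of_bool (rbar f n \<epsilon>max \<alpha> \<epsilon> < \<infinity> \<and>
     1 / real n * (\<Sum>i=1..n. of_bool (X i - (\<theta> + reps f n \<epsilon>max \<alpha> \<epsilon>) \<le> - teps f n \<epsilon>max \<alpha> \<epsilon>))
       < threshold f n \<epsilon>max \<alpha> \<epsilon>)"

lemma sets_location_law [simp]: "sets (location_law f \<theta>) = sets borel"
  by (simp add: location_law_def)

lemma sets_contaminated [simp]: "sets (contaminated f \<epsilon> \<theta> Q) = sets borel"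
  unfolding contaminated_def using sets.sigma_sets_eq[of "borel :: real measure"] by simp

lemma space_contaminated [simp]: "space (contaminated f \<epsilon> \<theta> Q) = UNIV"
  by (simp add: contaminated_def)

lemma emeasure_contaminated:
  assumes "sets Q = sets borel" "A \<in> sets borel"
  shows "emeasure (contaminated f \<epsilon> \<theta> Q) A =
    ennreal (1 - \<epsilon>) * emeasure (location_law f \<theta>) A + ennreal \<epsilon> * emeasure Q A"
proof (rule emeasure_measure_of[OF contaminated_def])
  show "countably_additive (sets (contaminated f \<epsilon> \<theta> Q))
    (\<lambda>A. ennreal (1 - \<epsilon>) * emeasure (location_law f \<theta>) A + ennreal \<epsilon> * emeasure Q A)"
  proof (rule countably_additiveI)
    fix B :: "nat \<Rightarrow> real set"
    assume B: "range B \<subseteq> sets (contaminated f \<epsilon> \<theta> Q)" "disjoint_family B"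
    have 1: "(\<Sum>i. emeasure (location_law f \<theta>) (B i)) = emeasure (location_law f \<theta>) (\<Union>i. B i)"
      using B by (intro suminf_emeasure) auto
    have 2: "(\<Sum>i. emeasure Q (B i)) = emeasure Q (\<Union>i. B i)"
      using B assms(1) by (intro suminf_emeasure) auto
    show "(\<Sum>i. ennreal (1 - \<epsilon>) * emeasure (location_law f \<theta>) (B i) + ennreal \<epsilon> * emeasure Q (B i)) =
      ennreal (1 - \<epsilon>) * emeasure (location_law f \<theta>) (\<Union>i. B i) + ennreal \<epsilon> * emeasure Q (\<Union>i. B i)"
      by (subst suminf_add[symmetric]) (auto simp: 1 2)
  qed
qed (use assms in \<open>auto simp: positive_def\<close>)

lemma prob_space_contaminated:
  assumes "prob_space (base_law f)" "Q \<in> prob_laws" "0 \<le> \<epsilon>" "\<epsilon> \<le> 1"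
  shows "prob_space (contaminated f \<epsilon> \<theta> Q)"
proof (rule prob_spaceI)
  have sQ: "sets Q = sets borel" "prob_space Q" using assms(2) by (auto simp: prob_laws_def)
  have 1: "prob_space (location_law f \<theta>)"
    unfolding location_law_def
    by (rule prob_space.prob_space_distr[OF assms(1)]) (simp add: base_law_def)
  have "emeasure (location_law f \<theta>) UNIV = 1" "emeasure Q UNIV = 1"
    using prob_space.emeasure_space_1[OF 1] prob_space.emeasure_space_1[OF sQ(2)]
      sets_eq_imp_space_eq[OF sQ(1)]
    by (auto simp: location_law_def)
  then show "emeasure (contaminated f \<epsilon> \<theta> Q) (space (contaminated f \<epsilon> \<theta> Q)) = 1"
    using assms(3,4) by (simp add: emeasure_contaminated[OF sQ(1)] flip: ennreal_plus)
qed

end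

theory Submission
  imports Defs
begin

text \<open>The critical point satisfies \<open>1 - F (t - r) \<ge> 6 (1 - F t) / (1 - \<epsilon>max)\<close> and
  \<open>1 - F (t - r) \<ge> qbar\<close>, by compactness of the constraint set. Hence the threshold is at most
  half of the mass that the uncontaminated part of the null law puts beyond \<open>t - r\<close>, while under
  the alternative it exceeds 3/2 of the mass beyond \<open>t\<close> by a margin of order \<open>1/n\<close>. The Type-2
  error is then a single Chernoff bound. For the Type-1 error, simultaneity in \<open>\<epsilon>\<close> reduces to a
  multiplicative lower deviation bound for the empirical survival function, uniform in \<open>s = t - r\<close>,
  which follows from monotonicity and Chernoff bounds on an arithmetic grid of levels.\<close>

section \<open>Deviation bounds for counts in an i.i.d. sample\<close>

lemma iid_count_measurable [measurable]:
  assumes [measurable]: "A \<in> sets N" and "finite I"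
  shows "(\<lambda>X. \<Sum>i\<in>I. of_bool (X i \<in> A) :: real) \<in> borel_measurable (\<Pi>\<^sub>M i\<in>I. N)"
proof -
  have "(\<lambda>X. \<Sum>i\<in>I. indicator A (X i) :: real) \<in> borel_measurable (\<Pi>\<^sub>M i\<in>I. N)"
    by measurable
  then show ?thesis by (simp add: indicator_def)
qed

text \<open>Independence factorises the moment, and \<open>1 + y \<le> exp y\<close> replaces each
  Bernoulli factor by the Poisson one. The sign of \<open>s\<close> is free, so both tails follow
  from this bound.\<close>

lemma iid_count_exponential_moment:
  fixes s :: real
  assumes "prob_space N" "A \<in> sets N" "finite I"
  shows "integrable (\<Pi>\<^sub>M i\<in>I. N) (\<lambda>X. exp (s * (\<Sum>i\<in>I. of_bool (X i \<in> A))))"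
    and "(\<integral>X. exp (s * (\<Sum>i\<in>I. of_bool (X i \<in> A))) \<partial>(\<Pi>\<^sub>M i\<in>I. N))
      \<le> exp (real (card I) * measure N A * (exp s - 1))"
proof -
  interpret N: prob_space N by fact
  interpret P: product_sigma_finite "\<lambda>i. N"
    by (simp add: product_sigma_finite_def N.sigma_finite_measure_axioms)
  \<comment> \<open>This is \<open>exp (s * indicator A x)\<close> written affinely in the
    indicator, so its integral can be read off.\<close>
  let ?h = "\<lambda>x. 1 + indicator A x * (exp s - 1) :: real"
  have h: "integrable N ?h"
    using assms(2) by (intro Bochner_Integration.integrable_add integrable_mult_left)
      (auto simp: less_top[symmetric] integrable_indicator_iff)
  have eq: "exp (s * (\<Sum>i\<in>I. of_bool (X i \<in> A))) = (\<Prod>i\<in>I. ?h (X i))" for X :: "'b \<Rightarrow> 'a"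
    unfolding sum_distrib_left exp_sum[OF assms(3)] by (rule prod.cong) (auto simp: indicator_def)
  show "integrable (\<Pi>\<^sub>M i\<in>I. N) (\<lambda>X. exp (s * (\<Sum>i\<in>I. of_bool (X i \<in> A))))"
    unfolding eq using h assms(3) by (intro P.product_integrable_prod) auto
  have "(\<integral>X. exp (s * (\<Sum>i\<in>I. of_bool (X i \<in> A))) \<partial>(\<Pi>\<^sub>M i\<in>I. N)) = (\<Prod>i\<in>I. integral\<^sup>L N ?h)"
    unfolding eq using h assms(3) by (intro P.product_integral_prod) auto
  also have "integral\<^sup>L N ?h = 1 + measure N A * (exp s - 1)"
    using assms(2)
    by (subst Bochner_Integration.integral_add) (auto simp: less_top[symmetric] integrable_indicator_iff N.prob_space Int_absorb2 sets.sets_into_space)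
  also have "(\<Prod>i\<in>I. 1 + measure N A * (exp s - 1)) = (1 + measure N A * (exp s - 1)) ^ card I"
    by simp
  also have "\<dots> \<le> exp (measure N A * (exp s - 1)) ^ card I"
  proof (rule power_mono)
    have "0 \<le> (1 - measure N A) + measure N A * exp s"
      using N.prob_le_1[of A] by (intro add_nonneg_nonneg) auto
    then show "0 \<le> 1 + measure N A * (exp s - 1)" by (simp add: algebra_simps)
  qed (rule exp_ge_add_one_self)
  also have "\<dots> = exp (real (card I) * measure N A * (exp s - 1))"
    by (simp add: exp_of_nat_mult[symmetric] mult.assoc)
  finally show "(\<integral>X. exp (s * (\<Sum>i\<in>I. of_bool (X i \<in> A))) \<partial>(\<Pi>\<^sub>M i\<in>I. N))
      \<le> exp (real (card I) * measure N A * (exp s - 1))" .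
qed

text \<open>Chernoff's inequality with parameter 3/5: since 3/5 * 3/2 = 9/10 is at least
  \<open>exp (3/5) - 1\<close>, the terms in \<open>\<mu>\<close> cancel, and 3/5 * 5/3 = 1 leaves
  exactly \<open>exp (- L)\<close>.\<close>

lemma iid_count_upper_tail:
  assumes N: "prob_space N" and A: "A \<in> sets N" and I: "finite I" and \<mu>: "measure N A \<le> \<mu>"
  shows "\<P>(X in (\<Pi>\<^sub>M i\<in>I. N). real (card I) * (3/2 * \<mu>) + 5/3 * L \<le> (\<Sum>i\<in>I. of_bool (X i \<in> A)))
    \<le> exp (- L)"
proof -
  interpret N: prob_space N by fact
  interpret P: prob_space "\<Pi>\<^sub>M i\<in>I. N" by (intro prob_space_PiM N)
  let ?S = "\<lambda>X. (\<Sum>i\<in>I. of_bool (X i \<in> A)) :: real" and ?a = "real (card I) * (3/2 * \<mu>) + 5/3 * L"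
  note mom = iid_count_exponential_moment[OF N A I, of "3/5"]
  \<comment> \<open>The quadratic bound at 3/5 itself would only give 1.96; applied at 3/20 and
    raised to the fourth power it stays below 1.9.\<close>
  have e: "exp (3/5::real) \<le> 19/10"
  proof -
    have "exp (3/20::real) \<le> 1 + 3/20 + (3/20)\<^sup>2" by (rule exp_bound) auto
    then have "exp (3/20::real) ^ 4 \<le> (1 + 3/20 + (3/20)\<^sup>2) ^ 4" by (rule power_mono) simp
    moreover have "exp (3/20::real) ^ 4 = exp (3/5)" by (simp flip: exp_of_nat_mult)
    moreover have "(1 + 3/20 + (3/20)\<^sup>2) ^ 4 \<le> (19/10::real)" by (simp add: power_divide)
    ultimately show ?thesis by linarith
  qed
  have "P.prob {X \<in> space (\<Pi>\<^sub>M i\<in>I. N). ?a \<le> ?S X} \<le>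
    exp (- (3/5) * ?a) * (\<integral>X\<in>space (\<Pi>\<^sub>M i\<in>I. N). exp (3/5 * ?S X) \<partial>(\<Pi>\<^sub>M i\<in>I. N))"
    by (rule P.Chernoff_ineq_ge) (use integrable_mult_indicator[OF sets.top mom(1)] in \<open>auto simp: set_integrable_def\<close>)
  also have "\<dots> = exp (- (3/5) * ?a) * (\<integral>X. exp (3/5 * ?S X) \<partial>(\<Pi>\<^sub>M i\<in>I. N))"
    using set_integral_space[OF mom(1)] by simp
  also have "\<dots> \<le> exp (- (3/5) * ?a) * exp (real (card I) * measure N A * (exp (3/5) - 1))"
    by (intro mult_left_mono mom(2)) auto
  also have "\<dots> \<le> exp (- (3/5) * ?a) * exp (real (card I) * \<mu> * (9/10))"
    using e \<mu> order_trans[OF measure_nonneg \<mu>]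
    by (intro mult_left_mono iffD2[OF exp_le_cancel_iff] mult_mono) auto
  also have "\<dots> = exp (- L)" by (simp add: mult_exp_exp algebra_simps)
  finally show ?thesis .
qed

text \<open>Chernoff's inequality with parameter -1/3: the bound 18/25 on
  \<open>exp (- (1/3))\<close> gains 7/25, the deviation level costs 1/3 * 3/4 = 1/4, and the
  difference is the rate 3/100.\<close>

lemma iid_count_lower_tail:
  assumes N: "prob_space N" and A: "A \<in> sets N" and I: "finite I" and u: "0 \<le> u" "u \<le> measure N A"
  shows "\<P>(X in (\<Pi>\<^sub>M i\<in>I. N). (\<Sum>i\<in>I. of_bool (X i \<in> A)) \<le> real (card I) * (3/4 * u))
    \<le> exp (- (3/100 * (real (card I) * u)))"
proof -
  interpret N: prob_space N by fact
  interpret P: prob_space "\<Pi>\<^sub>M i\<in>I. N" by (intro prob_space_PiM N)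
  let ?S = "\<lambda>X. (\<Sum>i\<in>I. of_bool (X i \<in> A)) :: real" and ?a = "real (card I) * (3/4 * u)"
  note mom = iid_count_exponential_moment[OF N A I, of "- (1/3)"]
  have "25/18 \<le> exp (1/3::real)"
    using exp_lower_Taylor_quadratic[of "1/3::real"] by (simp add: power2_eq_square)
  then have e: "exp (- (1/3)::real) \<le> 18/25"
    by (simp add: exp_minus field_simps)
  have "P.prob {X \<in> space (\<Pi>\<^sub>M i\<in>I. N). ?S X \<le> ?a} \<le>
    exp (1/3 * ?a) * (\<integral>X\<in>space (\<Pi>\<^sub>M i\<in>I. N). exp (- (1/3) * ?S X) \<partial>(\<Pi>\<^sub>M i\<in>I. N))"
    by (rule P.Chernoff_ineq_le) (use integrable_mult_indicator[OF sets.top mom(1)] in \<open>auto simp: set_integrable_def\<close>)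
  also have "\<dots> = exp (1/3 * ?a) * (\<integral>X. exp (- (1/3) * ?S X) \<partial>(\<Pi>\<^sub>M i\<in>I. N))"
    using set_integral_space[OF mom(1)] by simp
  also have "\<dots> \<le> exp (1/3 * ?a) * exp (real (card I) * measure N A * (exp (- (1/3)) - 1))"
    by (intro mult_left_mono mom(2)) auto
  also have "\<dots> \<le> exp (1/3 * ?a) * exp (real (card I) * u * (18/25 - 1))"
  proof -
    have "u * (7/25) \<le> measure N A * (1 - exp (- (1/3)))"
      using e u by (intro mult_mono) auto
    then have "real (card I) * (u * (7/25)) \<le> real (card I) * (measure N A * (1 - exp (- (1/3))))"
      by (rule mult_left_mono) simp
    then show ?thesis by (simp add: algebra_simps)
  qed
  also have "\<dots> = exp (- (3/100 * (real (card I) * u)))" by (simp add: mult_exp_exp algebra_simps)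
  finally show ?thesis .
qed

text \<open>Discretise the values of \<open>H\<close> at the levels \<open>(k + 2) * h\<close>: consecutive levels have ratio at
  most 3/2, so falling below half of \<open>H s\<close> forces the count at the next grid point, which is
  smaller by monotonicity, below 3/4 of its mean. The failure probabilities form a geometric
  series. The event itself need not be measurable, hence the measurable cover \<open>E\<close>.\<close>

lemma uniform_survival_lower_tail:
  fixes g :: "'a \<Rightarrow> real" and H :: "real \<Rightarrow> real"
  assumes N: "prob_space N" and g[measurable]: "g \<in> borel_measurable N"
    and I: "finite I" "I \<noteq> {}"
    and cont: "\<And>s. isCont H s" and anti: "antimono H" and lim: "(H \<longlongrightarrow> 0) at_top"
    and H: "\<And>s. H s \<le> measure N {x\<in>space N. s \<le> g x}"
    and L: "1 \<le> L"
  obtains E where "E \<in> sets (\<Pi>\<^sub>M i\<in>I. N)" "measure (\<Pi>\<^sub>M i\<in>I. N) E \<le> exp (- L)"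
    "\<And>X s. \<lbrakk>X \<in> space (\<Pi>\<^sub>M i\<in>I. N); 200 * L < real (card I) * H s;
      (\<Sum>i\<in>I. of_bool (s \<le> g (X i))) \<le> real (card I) * (H s / 2)\<rbrakk> \<Longrightarrow> X \<in> E"
proof -
  interpret N: prob_space N by fact
  interpret P: prob_space "\<Pi>\<^sub>M i\<in>I. N" by (intro prob_space_PiM N)
  let ?P = "\<Pi>\<^sub>M i\<in>I. N" and ?m = "real (card I)"
  have m: "?m > 0" using I by (simp add: card_gt_0_iff)
  \<comment> \<open>With this mesh the lower-tail exponent at level \<open>u k\<close> is
    \<open>3 * L * (k + 2)\<close>, and the condition \<open>200 * L < ?m * H s\<close> says that
    \<open>H s\<close> lies above the lowest level \<open>u 0 = 2 * h\<close>.\<close>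
  define h where "h = 100 * L / ?m"
  define u where "u k = (real k + 2) * h" for k
  have h: "h > 0" using m L by (simp add: h_def)
  have u: "u k > 0" for k using h by (simp add: u_def)
  \<comment> \<open>Every positive level below some value of \<open>H\<close> is attained, by
    continuity and the limit 0.\<close>
  have "\<exists>s. H s = u k" if k: "\<exists>s. u k < H s" for k
  proof -
    obtain a where a: "u k < H a" using k by auto
    have "eventually (\<lambda>b. H b < u k \<and> a \<le> b) at_top"
      using order_tendstoD(2)[OF lim u[of k]] eventually_ge_at_top[of a] by eventually_elim auto
    then obtain b where "H b < u k" "a \<le> b"
      using eventually_happens[of _ "at_top :: real filter"] by auto
    then show ?thesis using IVT2[of H b "u k" a] a cont by auto
  qed
  then obtain \<sigma> where \<sigma>: "\<And>k. \<exists>s. u k < H s \<Longrightarrow> H (\<sigma> k) = u k" by metis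
  let ?A = "\<lambda>s. {x\<in>space N. s \<le> g x}"
  have A: "?A s \<in> sets N" for s by measurable
  have S: "{X\<in>space ?P. (\<Sum>i\<in>I. of_bool (X i \<in> ?A s)) \<le> (c::real)} \<in> sets ?P" for s c
    by (intro borel_measurable_le iid_count_measurable A I) auto
  \<comment> \<open>If no value of \<open>H\<close> exceeds the level, there is no grid point to use
    and no \<open>s\<close> that calls for this \<open>k\<close>.\<close>
  define B where "B k = (if \<exists>s. u k < H s
     then {X\<in>space ?P. (\<Sum>i\<in>I. of_bool (X i \<in> ?A (\<sigma> k))) \<le> ?m * (3/4 * u k)} else {})" for k
  have B_sets: "B k \<in> sets ?P" for k
    using S by (simp only: B_def) (simp split: if_split)
  define x where "x = exp (- (3 * L))"
  have Bk: "P.prob (B k) \<le> x ^ 2 * x ^ k" for k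
  proof (cases "\<exists>s. u k < H s")
    case True
    have "P.prob (B k) \<le> exp (- (3/100 * (?m * u k)))"
      unfolding B_def if_P[OF True]
      using \<sigma>[OF True] H[of "\<sigma> k"] u[of k] I(1)
      by (intro iid_count_lower_tail N) auto
    also have "- (3/100 * (?m * u k)) = real (2 + k) * (- (3 * L))"
      using m by (simp add: u_def h_def field_simps)
    also have "exp \<dots> = x ^ (2 + k)"
      unfolding x_def by (rule exp_of_nat_mult)
    finally show ?thesis unfolding power_add .
  next
    case False
    then show ?thesis by (simp add: B_def x_def)
  qed
  have x: "0 < x" "x \<le> 1/4" "x \<le> exp (- L)"
  proof -
    have "4 \<le> exp (3 * L)" using exp_ge_add_one_self[of "3 * L"] L by linarith
    then show "x \<le> 1/4" by (simp add: x_def exp_minus field_simps)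
  qed (use L in \<open>auto simp: x_def\<close>)
  have sums: "(\<lambda>k. x ^ 2 * x ^ k) sums (x ^ 2 * (1 / (1 - x)))"
    using x by (intro sums_mult geometric_sums) auto
  have summ: "summable (\<lambda>k. P.prob (B k))"
    by (rule summable_comparison_test'[OF sums_summable[OF sums], of 0]) (use Bk in auto)
  have "P.prob (\<Union>k. B k) \<le> (\<Sum>k. P.prob (B k))"
    using B_sets by (intro P.finite_measure_subadditive_countably summ) auto
  also have "\<dots> \<le> (\<Sum>k. x ^ 2 * x ^ k)"
    by (intro suminf_le Bk summ sums_summable[OF sums])
  also have "\<dots> = x * (x / (1 - x))"
    using sums_unique[OF sums] by (simp add: power2_eq_square)
  \<comment> \<open>As \<open>x \<le> 1/4\<close>, the factor \<open>x / (1 - x)\<close> is at most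
    1, so the whole series costs no more than \<open>x\<close>.\<close>
  also have "\<dots> \<le> x * 1"
    using x by (intro mult_left_mono) (auto simp: field_simps)
  also have "\<dots> \<le> exp (- L)" using x by simp
  finally have small: "P.prob (\<Union>k. B k) \<le> exp (- L)" .
  show thesis
  proof (rule that[of "\<Union>k. B k"])
    fix X s
    assume X: "X \<in> space ?P" and big: "200 * L < ?m * H s"
      and le: "(\<Sum>i\<in>I. of_bool (s \<le> g (X i))) \<le> ?m * (H s / 2)"
    have "2 < H s / h" using big m L by (simp add: h_def field_simps)
    then have c: "3 \<le> \<lceil>H s / h\<rceil>" by linarith
    \<comment> \<open>The largest index with \<open>u k\<close> strictly below \<open>H s\<close>.
      Strictness is what lets antimonotonicity place \<open>\<sigma> k\<close> to the right of
      \<open>s\<close>.\<close>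
    define k where "k = nat (\<lceil>H s / h\<rceil> - 3)"
    have "real k + 2 < H s / h" "H s / h \<le> real k + 3"
      using c unfolding k_def by linarith+
    then have k: "u k < H s" "H s \<le> (real k + 3) * h"
      using h by (auto simp: u_def field_simps)
    have "H (\<sigma> k) = u k" using k(1) by (intro \<sigma>) blast
    then have "H (\<sigma> k) < H s" using k(1) by simp
    then have "s \<le> \<sigma> k" using antimonoD[OF anti, of "\<sigma> k" s] by linarith
    then have "(\<Sum>i\<in>I. of_bool (X i \<in> ?A (\<sigma> k))) \<le> (\<Sum>i\<in>I. of_bool (s \<le> g (X i)) :: real)"
      by (intro sum_mono) auto
    also have "\<dots> \<le> ?m * (H s / 2)" by (rule le)
    also have "\<dots> \<le> ?m * (3/4 * u k)"
    proof (rule mult_left_mono)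
      \<comment> \<open>The ratio (k + 3) / (k + 2) is largest at k = 0, where it is 3/2; this is
        why the levels start at \<open>2 * h\<close>.\<close>
      have "(real k + 3) * h \<le> 3/2 * u k"
        using h by (simp add: u_def field_simps)
      then show "H s / 2 \<le> 3/4 * u k" using k(2) by linarith
    qed simp
    finally have "X \<in> B k" using X k(1) by (auto simp: B_def)
    then show "X \<in> (\<Union>k. B k)" by auto
  qed (use B_sets small in auto)
qed

section \<open>The symmetric base law and its contaminations\<close>

locale symmetric_density =
  fixes f :: "real \<Rightarrow> real"
  assumes f_measurable[measurable]: "f \<in> borel_measurable borel"
    and prob_base: "prob_space (base_law f)"
    and f_sym: "\<And>x. f (- x) = f x"
begin

lemma sets_base_law [simp]: "sets (base_law f) = sets borel"
  by (simp add: base_law_def)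

lemma space_base_law [simp]: "space (base_law f) = UNIV"
  by (simp add: base_law_def)

sublocale base: real_distribution "base_law f"
  by (intro real_distribution.intro real_distribution_axioms.intro prob_base sets_base_law)

lemma base_law_singleton: "measure (base_law f) {x} = 0"
proof -
  have "{x} \<in> null_sets lborel" by (auto simp: null_sets_def)
  then have "emeasure (base_law f) {x} = 0"
    unfolding base_law_def by (subst emeasure_density) (auto intro: nn_integral_null_set)
  then show ?thesis by (simp add: measure_def)
qed

lemma isCont_base_cdf: "isCont (base_cdf f) x"
  by (simp add: base.isCont_cdf base_law_singleton)

lemma continuous_on_base_cdf [continuous_intros]:
  "continuous_on S h \<Longrightarrow> continuous_on S (\<lambda>x. base_cdf f (h x))"
  using isCont_base_cdf continuous_on_compose2[of UNIV "base_cdf f" S h]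
  by (auto simp: continuous_on_eq_continuous_at)

lemma base_law_upper: "measure (base_law f) {t..} = 1 - base_cdf f t"
proof -
  have "measure (base_law f) ({..t} \<union> {t..}) = measure (base_law f) {..t} + measure (base_law f) ({t..} - {..t})"
    by (subst base.finite_measure_Union') auto
  moreover have "measure (base_law f) ({t..} - {..t}) = measure (base_law f) {t..} - measure (base_law f) ({t..} \<inter> {..t})"
    by (rule base.finite_measure_Diff') auto
  moreover have "{..t} \<union> {t..} = space (base_law f)" "{t..} \<inter> {..t} = {t}" by auto
  ultimately show ?thesis
    using base.prob_space by (simp add: cdf_def base_law_singleton)
qed

lemma distr_base_law_uminus: "distr (base_law f) borel uminus = base_law f"
proof -
  have "base_law f = density (distr lborel borel uminus) (\<lambda>x. ennreal (f x))"
    by (simp add: base_law_def lborel_distr_uminus)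
  also have "\<dots> = distr (density lborel (\<lambda>x. ennreal (f (- x)))) borel uminus"
    by (rule density_distr) auto
  finally show ?thesis by (simp add: f_sym base_law_def)
qed

lemma base_law_lower: "measure (base_law f) {..- t} = 1 - base_cdf f t"
proof -
  have "measure (base_law f) {..- t} = measure (distr (base_law f) borel uminus) {..- t}"
    by (simp add: distr_base_law_uminus)
  also have "\<dots> = measure (base_law f) {t..}"
    by (subst measure_distr) (auto simp: vimage_def atLeast_def)
  finally show ?thesis by (simp add: base_law_upper)
qed

lemma measure_contaminated:
  assumes "Q \<in> prob_laws" "0 \<le> \<epsilon>" "\<epsilon> \<le> 1" "A \<in> sets borel"
  shows "measure (contaminated f \<epsilon> \<theta> Q) A =
    (1 - \<epsilon>) * measure (base_law f) {x. x + \<theta> \<in> A} + \<epsilon> * measure Q A"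
proof -
  interpret Q: prob_space Q using assms(1) by (simp add: prob_laws_def)
  have Q: "sets Q = sets borel" using assms(1) by (simp add: prob_laws_def)
  have "emeasure (location_law f \<theta>) A = emeasure (base_law f) {x. x + \<theta> \<in> A}"
    unfolding location_law_def using assms(4) by (subst emeasure_distr) (auto simp: vimage_def)
  then have "emeasure (contaminated f \<epsilon> \<theta> Q) A =
      ennreal ((1 - \<epsilon>) * measure (base_law f) {x. x + \<theta> \<in> A} + \<epsilon> * measure Q A)"
    using assms by (simp add: emeasure_contaminated[OF Q assms(4)] base.emeasure_eq_measure
      Q.emeasure_eq_measure flip: ennreal_plus ennreal_mult)
  then show ?thesis using assms by (intro measure_eq_emeasure_eq_ennreal) auto
qed

text \<open>The extremes are a contamination that misses \<open>A\<close> and one that lies inside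
  it. The lower bound serves the Type-1 error, the upper bound the Type-2 error.\<close>

lemma contaminated_bounds:
  assumes "Q \<in> prob_laws" "0 \<le> \<epsilon>" "\<epsilon> \<le> 1" "A \<in> sets borel"
  shows "(1 - \<epsilon>) * measure (base_law f) {x. x + \<theta> \<in> A} \<le> measure (contaminated f \<epsilon> \<theta> Q) A"
    and "measure (contaminated f \<epsilon> \<theta> Q) A \<le> measure (base_law f) {x. x + \<theta> \<in> A} + \<epsilon>"
proof -
  interpret Q: prob_space Q using assms(1) by (simp add: prob_laws_def)
  show "(1 - \<epsilon>) * measure (base_law f) {x. x + \<theta> \<in> A} \<le> measure (contaminated f \<epsilon> \<theta> Q) A"
    using assms by (simp add: measure_contaminated)
  have "(1 - \<epsilon>) * measure (base_law f) {x. x + \<theta> \<in> A} \<le> 1 * measure (base_law f) {x. x + \<theta> \<in> A}"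
    "\<epsilon> * measure Q A \<le> \<epsilon> * 1"
    using assms by (intro mult_right_mono mult_left_mono; simp)+
  then show "measure (contaminated f \<epsilon> \<theta> Q) A \<le> measure (base_law f) {x. x + \<theta> \<in> A} + \<epsilon>"
    using assms by (simp add: measure_contaminated)
qed

section \<open>Existence and properties of the critical point\<close>

text \<open>Once the quantile is known to be a finite number \<open>m \<ge> 0\<close>,
  \<open>t\<close> ranges over a compact interval on which the gap is continuous, so the supremum,
  the infimum and the greatest element are all attained. Then \<open>t - r \<le> m\<close>, and
  \<open>F\<close> at \<open>m\<close> is at most \<open>1 - qbar\<close>.\<close>

lemma critical_point:
  assumes fin: "rbar f n \<epsilon>max \<alpha> \<epsilon> < \<infinity>" and q: "0 < qbar n \<epsilon>max \<alpha> \<epsilon>"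
  defines "r \<equiv> reps f n \<epsilon>max \<alpha> \<epsilon>" and "t \<equiv> teps f n \<epsilon>max \<alpha> \<epsilon>"
  shows "qbar n \<epsilon>max \<alpha> \<epsilon> \<le> 1 - base_cdf f (t - r)" and "0 \<le> gap f \<epsilon>max r t"
proof -
  let ?q = "qbar n \<epsilon>max \<alpha> \<epsilon>" and ?Q = "base_quantile f (1 - qbar n \<epsilon>max \<alpha> \<epsilon>)"
  define T where "T \<rho> = {t. \<rho> \<le> t \<and> ereal t \<le> ereal \<rho> + ?Q}" for \<rho>
  define R where "R = {\<rho>. 0 \<le> \<rho> \<and> (SUP t\<in>T \<rho>. ereal (gap f \<epsilon>max \<rho> t)) \<ge> 0}"
  have rbar: "rbar f n \<epsilon>max \<alpha> \<epsilon> = (INF \<rho>\<in>R. ereal \<rho>)"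
    by (simp add: rbar_def R_def T_def)
  obtain b where b: "b \<in> R" using fin unfolding rbar by (cases "R = {}") (auto simp: top_ereal_def)
  \<comment> \<open>The supremum over the empty set is minus infinity, so an admissible
    \<open>b\<close> forces a nonempty range for \<open>t\<close>, hence a nonnegative
    quantile.\<close>
  then have "T b \<noteq> {}" by (auto simp: R_def bot_ereal_def)
  then have Q0: "0 \<le> ?Q" by (cases ?Q) (auto simp: T_def)
  have "eventually (\<lambda>t. 1 - ?q < base_cdf f t) at_top"
    using q by (intro order_tendstoD(1)[OF base.cdf_lim_at_top_prob]) auto
  then obtain t0 where "1 - ?q < base_cdf f t0"
    using eventually_happens[of _ "at_top :: real filter"] by auto
  then have "?Q \<le> ereal t0" unfolding base_quantile_def by (intro INF_lower) auto
  then obtain m where m: "?Q = ereal m" "0 \<le> m"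
    using Q0 by (cases ?Q) auto
  \<comment> \<open>If \<open>F\<close> exceeded the level at \<open>m\<close>, by continuity it
    would do so slightly to the left, against the minimality of the quantile.\<close>
  have Fm: "base_cdf f m \<le> 1 - ?q"
  proof (rule ccontr)
    assume "\<not> ?thesis"
    then have "eventually (\<lambda>x. 1 - ?q < base_cdf f x) (at_left m)"
      using isCont_base_cdf[of m] filterlim_at_split[of "base_cdf f" "nhds (base_cdf f m)" m]
      by (intro order_tendstoD(1)) (auto simp: isCont_def)
    then have "eventually (\<lambda>x. 1 - ?q < base_cdf f x \<and> x < m) (at_left m)"
      using eventually_at_left_real[of "m - 1" m, simplified] by eventually_elim auto
    then obtain x where x: "1 - ?q < base_cdf f x" "x < m"
      using eventually_happens[of _ "at_left m"] by auto
    then have "?Q \<le> ereal x" unfolding base_quantile_def by (intro INF_lower) auto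
    then show False using x m by simp
  qed
  have T: "T \<rho> = {\<rho>..\<rho> + m}" for \<rho> by (auto simp: T_def m)
  have cont: "continuous_on S (\<lambda>t. gap f \<epsilon>max \<rho> t)" for S \<rho>
    unfolding gap_def by (intro continuous_intros)
  have R_iff: "\<rho> \<in> R \<longleftrightarrow> 0 \<le> \<rho> \<and> (\<exists>t\<in>{\<rho>..\<rho> + m}. 0 \<le> gap f \<epsilon>max \<rho> t)" for \<rho>
  proof safe
    assume \<rho>: "\<rho> \<in> R"
    then show "0 \<le> \<rho>" by (simp add: R_def)
    obtain t1 where t1: "t1 \<in> {\<rho>..\<rho> + m}" "\<And>t. t \<in> {\<rho>..\<rho> + m} \<Longrightarrow> gap f \<epsilon>max \<rho> t \<le> gap f \<epsilon>max \<rho> t1"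
      using continuous_attains_sup[of "{\<rho>..\<rho> + m}" "gap f \<epsilon>max \<rho>"] cont m by auto
    have "0 \<le> (SUP t\<in>T \<rho>. ereal (gap f \<epsilon>max \<rho> t))" using \<rho> by (simp add: R_def)
    also have "\<dots> \<le> ereal (gap f \<epsilon>max \<rho> t1)" using t1 by (intro SUP_least) (auto simp: T)
    finally show "\<exists>t\<in>{\<rho>..\<rho> + m}. 0 \<le> gap f \<epsilon>max \<rho> t" using t1 by auto
  next
    fix t1 assume "0 \<le> \<rho>" "t1 \<in> {\<rho>..\<rho> + m}" "0 \<le> gap f \<epsilon>max \<rho> t1"
    then show "\<rho> \<in> R" by (auto simp: R_def T intro!: SUP_upper2[of t1])
  qed
  \<comment> \<open>Substituting \<open>t = \<rho> + s\<close> turns the moving interval into a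
    fixed one, so \<open>K\<close> is a closed subset of a rectangle. Cutting at the known member
    \<open>b\<close> makes it bounded, and its projection is the part of \<open>R\<close> up to
    \<open>b\<close>.\<close>
  define K where "K = {p \<in> {0..b} \<times> {0..m}. 0 \<le> gap f \<epsilon>max (fst p) (fst p + snd p)}"
  have "compact K"
  proof -
    have "closed K"
      unfolding K_def gap_def
      by (intro continuous_on_closed_Collect_le continuous_intros closed_Times closed_atLeastAtMost)
    then have "compact (({0..b} \<times> {0..m}) \<inter> K)"
      by (intro compact_Int_closed compact_Times compact_Icc)
    moreover have "({0..b} \<times> {0..m}) \<inter> K = K" unfolding K_def by blast
    ultimately show ?thesis by (simp only:)
  qed
  then have "compact (fst ` K)" by (intro compact_continuous_image continuous_intros)
  have K_iff: "\<rho> \<in> fst ` K \<longleftrightarrow> \<rho> \<in> R \<and> \<rho> \<le> b" for \<rho>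
  proof
    assume "\<rho> \<in> fst ` K"
    then obtain s where "(\<rho>, s) \<in> K" by auto
    then show "\<rho> \<in> R \<and> \<rho> \<le> b" by (auto simp: K_def R_iff intro!: bexI[of _ "\<rho> + s"])
  next
    assume \<rho>: "\<rho> \<in> R \<and> \<rho> \<le> b"
    then obtain t where "t \<in> {\<rho>..\<rho> + m}" "0 \<le> gap f \<epsilon>max \<rho> t" by (auto simp: R_iff)
    then have "(\<rho>, t - \<rho>) \<in> K" using \<rho> by (auto simp: K_def R_iff)
    then show "\<rho> \<in> fst ` K" by force
  qed
  then have "fst ` K \<noteq> {}" using b by blast
  then obtain \<rho> where \<rho>: "\<rho> \<in> R" "\<rho> \<le> b" "\<And>x. x \<in> R \<Longrightarrow> x \<le> b \<Longrightarrow> \<rho> \<le> x"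
    using compact_attains_inf[OF \<open>compact (fst ` K)\<close>] K_iff by metis
  have "rbar f n \<epsilon>max \<alpha> \<epsilon> = ereal \<rho>"
    unfolding rbar
  proof (rule antisym)
    show "(INF \<rho>\<in>R. ereal \<rho>) \<le> ereal \<rho>" using \<rho> by (intro INF_lower)
    \<comment> \<open>Members of \<open>R\<close> beyond \<open>b\<close> are harmless because
      \<open>\<rho> \<le> b\<close>.\<close>
    have "\<rho> \<le> x" if "x \<in> R" for x using \<rho>(2) \<rho>(3)[OF that] by linarith
    then show "ereal \<rho> \<le> (INF \<rho>\<in>R. ereal \<rho>)" by (intro INF_greatest) auto
  qed
  note rbar' = this
  have r: "r = \<rho>" by (simp add: r_def reps_def rbar')
  \<comment> \<open>The set whose greatest element defines \<open>teps\<close>; compactness ensures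
    that this element exists.\<close>
  define C where "C = {x \<in> {\<rho>..\<rho> + m}. 0 \<le> gap f \<epsilon>max \<rho> x}"
  have "compact C"
  proof -
    have "closed C" unfolding C_def
      by (intro continuous_on_closed_Collect_le cont continuous_intros closed_atLeastAtMost)
    then have "compact ({\<rho>..\<rho> + m} \<inter> C)" by (intro compact_Int_closed compact_Icc)
    moreover have "{\<rho>..\<rho> + m} \<inter> C = C" unfolding C_def by blast
    ultimately show ?thesis by (simp only:)
  qed
  moreover have "C \<noteq> {}" using \<rho>(1) by (auto simp: R_iff C_def)
  ultimately obtain t1 where t1: "t1 \<in> C" "\<And>x. x \<in> C \<Longrightarrow> x \<le> t1"
    using compact_attains_sup by metis
  have "t = t1"
    unfolding t_def teps_def r_def[symmetric] r rbar' m
    by (rule Greatest_equality) (use t1 in \<open>auto simp: C_def\<close>)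
  then have t: "\<rho> \<le> t" "t \<le> \<rho> + m" "0 \<le> gap f \<epsilon>max \<rho> t" using t1 by (auto simp: C_def)
  then show "0 \<le> gap f \<epsilon>max r t" by (simp add: r)
  have "base_cdf f (t - r) \<le> base_cdf f m"
    using t r by (intro base.cdf_nondecreasing) auto
  then show "?q \<le> 1 - base_cdf f (t - r)" using Fm by simp
qed

end

section \<open>Error bounds for the two tests\<close>

context symmetric_density
begin

text \<open>The threshold is tailored to the upper-tail bound: 3/2 * 10/9 = 5/3 matches its additive
  term with \<open>L = ln (4 / \<alpha>)\<close>, and \<open>1 - F t + \<epsilon>\<close> bounds the
  contaminated mass of \<open>A\<close>. A general \<open>A\<close> covers the half-lines of both
  tests.\<close>

lemma sample_upper_tail:
  assumes Q: "Q \<in> prob_laws" and \<epsilon>: "0 \<le> \<epsilon>" "\<epsilon> \<le> 1" and n: "0 < n" and \<alpha>: "0 < \<alpha>"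
    and A: "A \<in> sets borel" and p: "measure (base_law f) {x. x + \<theta> \<in> A} = 1 - base_cdf f (teps f n \<epsilon>max \<alpha> \<epsilon>)"
  shows "\<P>(X in sample_law f n \<epsilon> \<theta> Q.
    threshold f n \<epsilon>max \<alpha> \<epsilon> \<le> 1 / real n * (\<Sum>i=1..n. of_bool (X i \<in> A))) \<le> \<alpha> / 4"
proof -
  let ?\<mu> = "1 - base_cdf f (teps f n \<epsilon>max \<alpha> \<epsilon>) + \<epsilon>"
  have "threshold f n \<epsilon>max \<alpha> \<epsilon> \<le> 1 / real n * S \<longleftrightarrow>
      real (card {1..n}) * (3/2 * ?\<mu>) + 5/3 * ln (4 / \<alpha>) \<le> S" for S
  proof -
    have "real n * threshold f n \<epsilon>max \<alpha> \<epsilon> = real n * (3/2 * ?\<mu>) + 5/3 * ln (4 / \<alpha>)"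
      using n by (simp add: threshold_def field_simps)
    then show ?thesis using n by (simp add: pos_le_divide_eq mult.commute)
  qed
  then have "\<P>(X in sample_law f n \<epsilon> \<theta> Q.
      threshold f n \<epsilon>max \<alpha> \<epsilon> \<le> 1 / real n * (\<Sum>i=1..n. of_bool (X i \<in> A)))
    = \<P>(X in (\<Pi>\<^sub>M i\<in>{1..n}. contaminated f \<epsilon> \<theta> Q).
      real (card {1..n}) * (3/2 * ?\<mu>) + 5/3 * ln (4 / \<alpha>) \<le> (\<Sum>i\<in>{1..n}. of_bool (X i \<in> A)))"
    unfolding sample_law_def by simp
  also have "\<dots> \<le> exp (- ln (4 / \<alpha>))"
    using contaminated_bounds(2)[OF Q \<epsilon> A, of \<theta>] A
    by (intro iid_count_upper_tail prob_space_contaminated prob_base Q \<epsilon>) (auto simp: p)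
  also have "\<dots> = \<alpha> / 4" using \<alpha> by (simp add: exp_minus)
  finally show ?thesis .
qed

text \<open>At the critical point, \<open>1 - F (t - r)\<close> dominates both \<open>6 (1 - F t) / (1 - \<epsilon>max)\<close> and \<open>qbar\<close>.
  Averaging the two bounds puts the threshold below half of the uncontaminated mass at \<open>t - r\<close>.\<close>

lemma threshold_le_half_mass:
  assumes fin: "rbar f n \<epsilon>max \<alpha> \<epsilon> < \<infinity>" and \<epsilon>: "0 \<le> \<epsilon>" and \<epsilon>max: "0 < \<epsilon>max" "\<epsilon>max < 1"
    and \<alpha>: "0 < \<alpha>" "\<alpha> < 1" and n: "0 < n"
  defines "v \<equiv> (1 - \<epsilon>max) * (1 - base_cdf f (teps f n \<epsilon>max \<alpha> \<epsilon> - reps f n \<epsilon>max \<alpha> \<epsilon>))"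
  shows "200 * ln (32 / \<alpha>) < real n * v" and "threshold f n \<epsilon>max \<alpha> \<epsilon> \<le> v / 2"
proof -
  let ?L = "ln (32 / \<alpha>)" and ?G = "1 - base_cdf f (teps f n \<epsilon>max \<alpha> \<epsilon>)"
  have L: "0 < ?L" using \<alpha> by (intro ln_gt_zero) auto
  have L4: "ln (4 / \<alpha>) \<le> ?L" using \<alpha> by (intro ln_mono) (auto simp: divide_right_mono)
  have q: "0 < qbar n \<epsilon>max \<alpha> \<epsilon>"
    unfolding qbar_def using L \<epsilon> \<epsilon>max n by (intro mult_pos_pos add_nonneg_pos divide_pos_pos) auto
  note crit = critical_point[OF fin q]
  have v1: "6 * (\<epsilon> + 100 * ?L / (3 * (1 - \<epsilon>max) * real n)) \<le> v"
  proof -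
    have "(1 - \<epsilon>max) * qbar n \<epsilon>max \<alpha> \<epsilon> \<le> v"
      unfolding v_def using crit(1) \<epsilon>max by (intro mult_left_mono) auto
    then show ?thesis using \<epsilon>max by (simp add: qbar_def)
  qed
  have v2: "6 * ?G \<le> v"
  proof -
    have "(1 - \<epsilon>max) * (6 / (1 - \<epsilon>max) * ?G) \<le> v"
      unfolding v_def using crit(2) \<epsilon>max by (intro mult_left_mono) (auto simp: gap_def)
    then show ?thesis using \<epsilon>max by simp
  qed
  \<comment> \<open>The factor \<open>1 - \<epsilon>max < 1\<close> supplies the strict inequality
    required by the uniform deviation bound.\<close>
  have ratio: "?L / real n < ?L / ((1 - \<epsilon>max) * real n)"
    using L \<epsilon>max n by (intro divide_strict_left_mono) auto
  have v1': "6 * \<epsilon> + 200 * (?L / ((1 - \<epsilon>max) * real n)) \<le> v"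
  proof -
    have "6 * (\<epsilon> + 100 * ?L / (3 * d)) = 6 * \<epsilon> + 200 * (?L / d)" for d :: real by simp
    then show ?thesis using v1 by (metis mult.assoc)
  qed
  then have "200 * (?L / real n) < v" using ratio \<epsilon> by linarith
  then show "200 * ?L < real n * v" using n by (simp add: field_simps)
  have "threshold f n \<epsilon>max \<alpha> \<epsilon> = 3/2 * ?G + 5/3 * (ln (4 / \<alpha>) / real n) + 3/2 * \<epsilon>"
    by (simp add: threshold_def algebra_simps)
  moreover have "ln (4 / \<alpha>) / real n \<le> ?L / real n" "0 < ?L / real n"
    using L4 L n by (auto intro: divide_right_mono)
  \<comment> \<open>A quarter of \<open>v2\<close> pays for \<open>3/2 * ?G\<close>. A quarter of
    \<open>v1'\<close> pays for \<open>3/2 * \<epsilon>\<close> and leaves more than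
    \<open>50 * ?L / n\<close> for the last term, which is at most
    \<open>5/3 * ?L / n\<close>.\<close>
  ultimately show "threshold f n \<epsilon>max \<alpha> \<epsilon> \<le> v / 2" using v1' v2 ratio by linarith
qed

text \<open>A rejection at any \<open>\<epsilon>\<close> makes the empirical survival function of
  \<open>g\<close> at \<open>s = t - r\<close> at most half of \<open>?H s\<close>, which puts the
  sample into one exceptional event \<open>E\<close> that does not depend on
  \<open>\<epsilon>\<close>. The function \<open>g\<close> abstracts over the sign of the
  alternative.\<close>

lemma simultaneous_type1_error:
  assumes Q: "Q \<in> prob_laws" and \<epsilon>max: "0 < \<epsilon>max" "\<epsilon>max < 1"
    and \<alpha>: "0 < \<alpha>" "\<alpha> < 1" and n: "0 < n"
    and g[measurable]: "g \<in> borel_measurable borel"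
    and p: "\<And>s. measure (base_law f) {x. s \<le> g (x + \<theta>)} = 1 - base_cdf f s"
    and \<phi>: "\<And>\<epsilon> X. \<phi> \<epsilon> X \<in> {0, 1}" "\<And>\<epsilon> X. \<phi> \<epsilon> X = 1 \<Longrightarrow> rbar f n \<epsilon>max \<alpha> \<epsilon> < \<infinity> \<and>
      1 / real n * (\<Sum>i=1..n. of_bool (teps f n \<epsilon>max \<alpha> \<epsilon> - reps f n \<epsilon>max \<alpha> \<epsilon> \<le> g (X i)))
        \<le> threshold f n \<epsilon>max \<alpha> \<epsilon>"
  shows "\<P>(X in sample_law f n \<epsilon>max \<theta> Q. (SUP \<epsilon>\<in>{0..\<epsilon>max}. \<phi> \<epsilon> X) = (1::real)) \<le> \<alpha> / 4"
proof -
  let ?N = "contaminated f \<epsilon>max \<theta> Q" and ?H = "\<lambda>s. (1 - \<epsilon>max) * (1 - base_cdf f s)"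
  have N: "prob_space ?N" using Q \<epsilon>max by (intro prob_space_contaminated prob_base) auto
  interpret P: prob_space "sample_law f n \<epsilon>max \<theta> Q"
    unfolding sample_law_def by (intro prob_space_PiM N)
  have "32 \<le> 32 / \<alpha>" using \<alpha> by (simp add: field_simps)
  then have "exp 1 \<le> 32 / \<alpha>" using exp_le by linarith
  then have L: "1 \<le> ln (32 / \<alpha>)" using \<alpha> by (subst ln_ge_iff) auto
  have H: "?H s \<le> measure ?N {x\<in>space ?N. s \<le> g x}" for s
    using contaminated_bounds(1)[OF Q, of \<epsilon>max "{x. s \<le> g x}" \<theta>] \<epsilon>max by (simp add: p)
  have "(?H \<longlongrightarrow> (1 - \<epsilon>max) * (1 - 1)) at_top"
    by (intro tendsto_intros base.cdf_lim_at_top_prob)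
  then have lim: "(?H \<longlongrightarrow> 0) at_top" by simp
  have cont: "isCont ?H s" for s
    by (intro continuous_intros isCont_base_cdf)
  have anti: "antimono ?H"
    using \<epsilon>max by (intro antimonoI mult_left_mono diff_left_mono base.cdf_nondecreasing) auto
  have gN: "g \<in> borel_measurable ?N" using g by (simp cong: measurable_cong_sets)
  obtain E where E: "E \<in> sets (\<Pi>\<^sub>M i\<in>{1..n}. ?N)" "measure (\<Pi>\<^sub>M i\<in>{1..n}. ?N) E \<le> exp (- ln (32 / \<alpha>))"
    "\<And>X s. \<lbrakk>X \<in> space (\<Pi>\<^sub>M i\<in>{1..n}. ?N); 200 * ln (32 / \<alpha>) < real (card {1..n}) * ?H s;
      (\<Sum>i\<in>{1..n}. of_bool (s \<le> g (X i))) \<le> real (card {1..n}) * (?H s / 2)\<rbrakk> \<Longrightarrow> X \<in> E"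
    by (rule uniform_survival_lower_tail[OF N gN _ _ cont anti lim H L, of "{1..n}"]) (use n in auto)
  have "\<P>(X in sample_law f n \<epsilon>max \<theta> Q. (SUP \<epsilon>\<in>{0..\<epsilon>max}. \<phi> \<epsilon> X) = (1::real))
      \<le> measure (sample_law f n \<epsilon>max \<theta> Q) E"
  \<comment> \<open>Monotonicity asks for measurability of the larger set \<open>E\<close> only, not
    of the uncountable union of rejections.\<close>
  proof (rule P.finite_measure_mono)
    show "E \<in> sets (sample_law f n \<epsilon>max \<theta> Q)" using E(1) by (simp add: sample_law_def)
    show "{X \<in> space (sample_law f n \<epsilon>max \<theta> Q). (SUP \<epsilon>\<in>{0..\<epsilon>max}. \<phi> \<epsilon> X) = 1} \<subseteq> E"
    proof safe
      fix X assume X: "X \<in> space (sample_law f n \<epsilon>max \<theta> Q)" and sup: "(SUP \<epsilon>\<in>{0..\<epsilon>max}. \<phi> \<epsilon> X) = 1"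
      have "\<exists>\<epsilon>\<in>{0..\<epsilon>max}. \<phi> \<epsilon> X = 1"
      \<comment> \<open>The tests take values 0 and 1, so without a rejection the supremum would be
        0.\<close>
      proof (rule ccontr)
        assume "\<not> ?thesis"
        then have "\<phi> \<epsilon> X = 0" if "\<epsilon> \<in> {0..\<epsilon>max}" for \<epsilon> using \<phi>(1)[of \<epsilon> X] that by auto
        then have "(SUP \<epsilon>\<in>{0..\<epsilon>max}. \<phi> \<epsilon> X) = (SUP \<epsilon>\<in>{0..\<epsilon>max}. 0)" by (intro SUP_cong) auto
        then show False using sup \<epsilon>max by simp
      qed
      then obtain \<epsilon> where \<epsilon>: "0 \<le> \<epsilon>" "\<phi> \<epsilon> X = 1" by auto
      note \<phi>1 = \<phi>(2)[OF \<epsilon>(2)]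
      let ?s = "teps f n \<epsilon>max \<alpha> \<epsilon> - reps f n \<epsilon>max \<alpha> \<epsilon>"
      note v = threshold_le_half_mass[OF conjunct1[OF \<phi>1] \<epsilon>(1) \<epsilon>max \<alpha> n]
      have "1 / real n * (\<Sum>i=1..n. of_bool (?s \<le> g (X i))) \<le> ?H ?s / 2"
        using \<phi>1 v(2) by linarith
      then have "(\<Sum>i=1..n. of_bool (?s \<le> g (X i))) \<le> real n * (?H ?s / 2)"
        using n by (simp add: field_simps)
      then show "X \<in> E" using E(3)[of X ?s] X v(1) by (simp add: sample_law_def)
    qed
  qed
  also have "\<dots> \<le> exp (- ln (32 / \<alpha>))" using E(2) by (simp add: sample_law_def)
  \<comment> \<open>The exceptional probability is in fact \<open>\<alpha> / 32\<close>.\<close>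
  also have "\<dots> \<le> \<alpha> / 4" using \<alpha> by (simp add: exp_minus)
  finally show ?thesis .
qed

text \<open>With \<open>rbar\<close> finite, acceptance means that the frequency strictly exceeds
  the threshold, which is contained in the upper-tail event. Under the alternative the half-line has
  uncontaminated mass \<open>1 - F t\<close>.\<close>

lemma type2_error_minus:
  assumes "Q \<in> prob_laws" "0 \<le> \<epsilon>" "\<epsilon> \<le> 1" "0 < n" "0 < \<alpha>" "rbar f n \<epsilon>max \<alpha> \<epsilon> < \<infinity>"
  shows "\<P>(X in sample_law f n \<epsilon> (\<theta> - reps f n \<epsilon>max \<alpha> \<epsilon>) Q.
    phi_minus f n \<epsilon>max \<alpha> \<theta> \<epsilon> X = 0) \<le> \<alpha> / 4"
proof -
  let ?r = "reps f n \<epsilon>max \<alpha> \<epsilon>" and ?t = "teps f n \<epsilon>max \<alpha> \<epsilon>"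
  let ?A = "{x. x - (\<theta> - ?r) \<ge> ?t}" and ?M = "sample_law f n \<epsilon> (\<theta> - ?r) Q"
  interpret P: prob_space ?M
    unfolding sample_law_def by (intro prob_space_PiM prob_space_contaminated prob_base assms)
  have A: "?A \<in> sets borel" by measurable
  have p: "measure (base_law f) {x. x + (\<theta> - ?r) \<in> ?A} = 1 - base_cdf f ?t"
    by (simp add: base_law_upper[symmetric] atLeast_def)
  have "\<P>(X in ?M. phi_minus f n \<epsilon>max \<alpha> \<theta> \<epsilon> X = 0) \<le>
      \<P>(X in ?M. threshold f n \<epsilon>max \<alpha> \<epsilon> \<le> 1 / real n * (\<Sum>i=1..n. of_bool (X i \<in> ?A)))"
  proof (rule P.finite_measure_mono)
    show "{X \<in> space ?M. threshold f n \<epsilon>max \<alpha> \<epsilon> \<le> 1 / real n * (\<Sum>i=1..n. of_bool (X i \<in> ?A))} \<in> sets ?M"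
      unfolding sample_law_def using A
      by (intro borel_measurable_le borel_measurable_times iid_count_measurable) auto
  qed (use assms(6) in \<open>auto simp: phi_minus_def simp del: sum_of_bool_eq\<close>)
  also have "\<dots> \<le> \<alpha> / 4" by (intro sample_upper_tail assms A p)
  finally show ?thesis .
qed

text \<open>This test rejects on a strict inequality, so acceptance is exactly the upper-tail event;
  symmetry gives the lower half-line the mass \<open>1 - F t\<close>.\<close>

lemma type2_error_plus:
  assumes "Q \<in> prob_laws" "0 \<le> \<epsilon>" "\<epsilon> \<le> 1" "0 < n" "0 < \<alpha>" "rbar f n \<epsilon>max \<alpha> \<epsilon> < \<infinity>"
  shows "\<P>(X in sample_law f n \<epsilon> (\<theta> + reps f n \<epsilon>max \<alpha> \<epsilon>) Q.
    phi_plus f n \<epsilon>max \<alpha> \<theta> \<epsilon> X = 0) \<le> \<alpha> / 4"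
proof -
  let ?r = "reps f n \<epsilon>max \<alpha> \<epsilon>" and ?t = "teps f n \<epsilon>max \<alpha> \<epsilon>"
  let ?A = "{x. x - (\<theta> + ?r) \<le> - ?t}" and ?M = "sample_law f n \<epsilon> (\<theta> + ?r) Q"
  have A: "?A \<in> sets borel" by measurable
  have p: "measure (base_law f) {x. x + (\<theta> + ?r) \<in> ?A} = 1 - base_cdf f ?t"
    by (simp add: base_law_lower[symmetric] atMost_def)
  have "\<P>(X in ?M. phi_plus f n \<epsilon>max \<alpha> \<theta> \<epsilon> X = 0) =
      \<P>(X in ?M. threshold f n \<epsilon>max \<alpha> \<epsilon> \<le> 1 / real n * (\<Sum>i=1..n. of_bool (X i \<in> ?A)))"
    using assms(6) by (simp add: phi_plus_def not_less del: sum_of_bool_eq)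
  also have "\<dots> \<le> \<alpha> / 4" by (intro sample_upper_tail assms A p)
  finally show ?thesis .
qed

lemma type1_error_minus:
  assumes "Q \<in> prob_laws" "0 < \<epsilon>max" "\<epsilon>max < 1" "0 < \<alpha>" "\<alpha> < 1" "0 < n"
  shows "\<P>(X in sample_law f n \<epsilon>max \<theta> Q.
    (SUP \<epsilon>\<in>{0..\<epsilon>max}. phi_minus f n \<epsilon>max \<alpha> \<theta> \<epsilon> X) = 1) \<le> \<alpha> / 4"
proof (rule simultaneous_type1_error[where g = "\<lambda>x. x - \<theta>", OF assms])
  show "measure (base_law f) {x. s \<le> x + \<theta> - \<theta>} = 1 - base_cdf f s" for s
    by (simp add: base_law_upper[symmetric] atLeast_def)
  have "x - (\<theta> - r) \<ge> t \<longleftrightarrow> t - r \<le> x - \<theta>" for x r t by linarith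
  then show "rbar f n \<epsilon>max \<alpha> \<epsilon> < \<infinity> \<and>
      1 / real n * (\<Sum>i=1..n. of_bool (teps f n \<epsilon>max \<alpha> \<epsilon> - reps f n \<epsilon>max \<alpha> \<epsilon> \<le> X i - \<theta>))
        \<le> threshold f n \<epsilon>max \<alpha> \<epsilon>" if "phi_minus f n \<epsilon>max \<alpha> \<theta> \<epsilon> X = 1" for \<epsilon> X
    using that unfolding phi_minus_def by simp
qed (auto simp: phi_minus_def)

text \<open>The reflection \<open>\<theta> - x\<close> turns lower counts into survival counts, and
  by symmetry their uncontaminated survival function is again \<open>1 - F\<close>.\<close>

lemma type1_error_plus:
  assumes "Q \<in> prob_laws" "0 < \<epsilon>max" "\<epsilon>max < 1" "0 < \<alpha>" "\<alpha> < 1" "0 < n"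
  shows "\<P>(X in sample_law f n \<epsilon>max \<theta> Q.
    (SUP \<epsilon>\<in>{0..\<epsilon>max}. phi_plus f n \<epsilon>max \<alpha> \<theta> \<epsilon> X) = 1) \<le> \<alpha> / 4"
proof (rule simultaneous_type1_error[where g = "\<lambda>x. \<theta> - x", OF assms])
  have "s \<le> \<theta> - (x + \<theta>) \<longleftrightarrow> x \<le> - s" for s x by linarith
  then show "measure (base_law f) {x. s \<le> \<theta> - (x + \<theta>)} = 1 - base_cdf f s" for s
    by (simp only: base_law_lower[symmetric] atMost_def)
  have "x - (\<theta> + r) \<le> - t \<longleftrightarrow> t - r \<le> \<theta> - x" for x r t by linarith
  then show "rbar f n \<epsilon>max \<alpha> \<epsilon> < \<infinity> \<and>
      1 / real n * (\<Sum>i=1..n. of_bool (teps f n \<epsilon>max \<alpha> \<epsilon> - reps f n \<epsilon>max \<alpha> \<epsilon> \<le> \<theta> - X i))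
        \<le> threshold f n \<epsilon>max \<alpha> \<epsilon>" if "phi_plus f n \<epsilon>max \<alpha> \<theta> \<epsilon> X = 1" for \<epsilon> X
    using that unfolding phi_plus_def by simp
qed (auto simp: phi_plus_def)

end

theorem theorem3:
  fixes f :: "real \<Rightarrow> real" and n :: nat and \<epsilon>max \<alpha> :: real
  assumes "f \<in> borel_measurable borel"
    and "\<And>x. 0 \<le> f x"
    and "prob_space (base_law f)"
    and "continuous_on {x. f x > 0} f"
    and "\<And>x. f (- x) = f x"
    and "n \<ge> 400"
    and "0 < \<epsilon>max" and "\<epsilon>max < 1"
    and "0 < \<alpha>" and "\<alpha> < 1"
    and "qbar n \<epsilon>max \<alpha> \<epsilon>max \<le> 1"
  shows "\<forall>\<theta>::real. \<forall>\<epsilon>\<in>{0..\<epsilon>max}.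
    (SUP Q\<in>prob_laws. \<P>(X in sample_law f n \<epsilon>max \<theta> Q.
        (SUP \<epsilon>'\<in>{0..\<epsilon>max}. phi_minus f n \<epsilon>max \<alpha> \<theta> \<epsilon>' X) = 1)) \<le> \<alpha> / 4 \<and>
    (SUP Q\<in>prob_laws. \<P>(X in sample_law f n \<epsilon>max \<theta> Q.
        (SUP \<epsilon>'\<in>{0..\<epsilon>max}. phi_plus f n \<epsilon>max \<alpha> \<theta> \<epsilon>' X) = 1)) \<le> \<alpha> / 4 \<and>
    (rbar f n \<epsilon>max \<alpha> \<epsilon> < \<infinity> \<longrightarrow>
      (SUP Q\<in>prob_laws. \<P>(X in sample_law f n \<epsilon> (\<theta> - reps f n \<epsilon>max \<alpha> \<epsilon>) Q.
        phi_minus f n \<epsilon>max \<alpha> \<theta> \<epsilon> X = 0)) \<le> \<alpha> / 4 \<and>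
      (SUP Q\<in>prob_laws. \<P>(X in sample_law f n \<epsilon> (\<theta> + reps f n \<epsilon>max \<alpha> \<epsilon>) Q.
        phi_plus f n \<epsilon>max \<alpha> \<theta> \<epsilon> X = 0)) \<le> \<alpha> / 4)"
proof -
  interpret symmetric_density f by (rule symmetric_density.intro) fact+
  \<comment> \<open>Bounding a real supremum by a bound on its terms requires a nonempty family; the
    base law is a member.\<close>
  have ne: "prob_laws \<noteq> {}"
    using prob_base by (auto simp: prob_laws_def intro!: exI[of _ "base_law f"])
  have n: "0 < n" using assms(6) by simp
  show ?thesis
    by (intro allI ballI conjI impI cSUP_least ne type1_error_minus type1_error_plus
        type2_error_minus type2_error_plus)
      (use assms(7-10) n in auto)
qed

end
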